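(* Let $f=x^4-x^2\in\mathbb{R}[x]$, whose set of critical values is $\{0,-1/4\}$, and let $\gamma(t)$, $t\in(-1/4,0)$, be a continuous family of simple cycles in the fibers of $f$. For $n\ge1$ let $V_n$ be the real vector space of Abelian integrals $I(t)=\int_{\gamma(t)}\omega$ on $(-1/4,0)$, where $\omega\in\mathbb{R}[x]$, $\deg\omega\le n$. Then $V_n$ is Chebyshev: each $I\in V_n$ which is not identically zero has at most $\dim V_n-1$ zeros in $(-1/4,0)$.
   Context: A simple cycle in $f^{-1}(t)$ is a formal difference $x_i-x_j$ of two distinct roots of $f(x)=t$. A continuous family of simple cycles on $(-1/4,0)$ is $\gamma(t)=x_i(t)-x_j(t)$, where $x_i,x_j$ are continuous functions on $(-1/4,0)$ with $f(x_i(t))=f(x_j(t))=t$ and $x_i(t)\neq x_j(t)$ for all $t$. One sets $\int_{\gamma(t)}\omega=\omega(x_i(t))-\omega(x_j(t))$. *)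

theory Defs
  imports "HOL-Analysis.Analysis" "HOL-Computational_Algebra.Polynomial"
    "HOL-Library.Function_Algebras"
begin

instantiation "fun" :: (type, real_vector) real_vector
begin

definition scaleR_fun_def: "c *\<^sub>R f = (\<lambda>x. c *\<^sub>R f x)"

instance
  by standard (simp_all add: scaleR_fun_def fun_eq_iff scaleR_add_right scaleR_add_left)

end

text \<open>Evaluation at complex points of a polynomial with real coefficients.\<close>

definition cpoly :: "real poly \<Rightarrow> complex \<Rightarrow> complex" where
  "cpoly p z = poly (map_poly complex_of_real p) z"

lemma cpoly_0: "cpoly 0 z = 0"
  by (simp add: cpoly_def)

lemma cpoly_add: "cpoly (p + q) z = cpoly p z + cpoly q z"
proof -
  have "map_poly complex_of_real (p + q) = map_poly complex_of_real p + map_poly complex_of_real q"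
    by (rule poly_eqI) (simp add: coeff_map_poly)
  then show ?thesis by (simp add: cpoly_def)
qed

lemma cpoly_smult: "cpoly (smult c p) z = c *\<^sub>R cpoly p z"
proof -
  have "map_poly complex_of_real (smult c p) = smult (of_real c) (map_poly complex_of_real p)"
    by (rule poly_eqI) (simp add: coeff_map_poly)
  then show ?thesis by (simp add: cpoly_def scaleR_conv_of_real)
qed

lemma cpoly_diff: "cpoly (p - q) z = cpoly p z - cpoly q z"
  using cpoly_add[of "p - q" q z] by simp

lemma cpoly_monom: "cpoly (monom c k) z = of_real c * z ^ k"
  by (simp add: cpoly_def map_poly_monom poly_monom)

definition f0 :: "real poly" where
  "f0 = monom 1 4 - monom 1 2"

definition critical_values :: "real poly \<Rightarrow> complex set" where
  "critical_values f = {cpoly f z | z. cpoly (pderiv f) z = 0}"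

lemma critical_values_f0: "critical_values f0 = {0, - 1 / 4}"
proof -
  have f: "cpoly f0 z = z ^ 4 - z ^ 2" for z
    by (simp add: f0_def cpoly_diff cpoly_monom)
  have f': "cpoly (pderiv f0) z = 4 * z ^ 3 - 2 * z" for z
    by (simp add: f0_def pderiv_diff pderiv_monom cpoly_diff cpoly_monom)
  have crit: "4 * z ^ 3 - 2 * z = 0 \<longleftrightarrow> z = 0 \<or> z ^ 2 = 1 / 2" for z :: complex
  proof -
    have "4 * z ^ 3 - 2 * z = 4 * (z * (z ^ 2 - 1 / 2))"
      by (simp add: algebra_simps power2_eq_square power3_eq_cube)
    then show ?thesis by simp
  qed
  have val: "z ^ 4 - z ^ 2 = - 1 / 4" if "z ^ 2 = 1 / 2" for z :: complex
  proof -
    have "z ^ 4 = (z ^ 2) ^ 2" by (simp flip: power_mult)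
    then show ?thesis by (simp only: that) (simp add: power2_eq_square)
  qed
  have half: "(csqrt (1 / 2)) ^ 2 = 1 / 2" by (rule power2_csqrt)
  have "critical_values f0 = {z ^ 4 - z ^ 2 | z. z = 0 \<or> z ^ 2 = 1 / 2}"
    unfolding critical_values_def f f' crit ..
  also have "\<dots> = {0, - 1 / 4}"
  proof (intro equalityI subsetI)
    fix w :: complex
    assume "w \<in> {z ^ 4 - z ^ 2 | z. z = 0 \<or> z ^ 2 = 1 / 2}"
    then obtain z where "w = z ^ 4 - z ^ 2" "z = 0 \<or> z ^ 2 = 1 / 2" by blast
    then show "w \<in> {0, - 1 / 4}" using val[of z] by (elim disjE) simp_all
  next
    fix w :: complex
    assume "w \<in> {0, - 1 / 4}"
    then consider "w = 0 ^ 4 - 0 ^ 2" | "w = csqrt (1 / 2) ^ 4 - csqrt (1 / 2) ^ 2"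
      using val[OF half] by auto
    then show "w \<in> {z ^ 4 - z ^ 2 | z. z = 0 \<or> z ^ 2 = 1 / 2}"
      using half by cases blast+
  qed
  finally show ?thesis .
qed

text \<open>
  The formal difference \<open>x\<^sub>i - x\<^sub>j\<close> is represented by the ordered pair of its two
  continuous branches.
\<close>

definition simple_cycle_family ::
    "real poly \<Rightarrow> real set \<Rightarrow> (real \<Rightarrow> complex) \<Rightarrow> (real \<Rightarrow> complex) \<Rightarrow> bool" where
  "simple_cycle_family f J x\<^sub>i x\<^sub>j \<longleftrightarrow>
     continuous_on J x\<^sub>i \<and> continuous_on J x\<^sub>j \<and>
     (\<forall>t\<in>J. cpoly f (x\<^sub>i t) = of_real t \<and> cpoly f (x\<^sub>j t) = of_real t \<and> x\<^sub>i t \<noteq> x\<^sub>j t)"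

text \<open>
  Functions on \<open>J\<close> are represented by total functions vanishing outside \<open>J\<close>, so that two
  integrals are equal as HOL functions iff they agree on \<open>J\<close>.
\<close>

definition abelian_integral ::
    "real set \<Rightarrow> (real \<Rightarrow> complex) \<Rightarrow> (real \<Rightarrow> complex) \<Rightarrow> real poly \<Rightarrow> real \<Rightarrow> complex" where
  "abelian_integral J x\<^sub>i x\<^sub>j \<omega> t = (if t \<in> J then cpoly \<omega> (x\<^sub>i t) - cpoly \<omega> (x\<^sub>j t) else 0)"

definition abelian_integrals ::
    "real set \<Rightarrow> (real \<Rightarrow> complex) \<Rightarrow> (real \<Rightarrow> complex) \<Rightarrow> nat \<Rightarrow> (real \<Rightarrow> complex) set" where
  "abelian_integrals J x\<^sub>i x\<^sub>j n = {abelian_integral J x\<^sub>i x\<^sub>j \<omega> | \<omega>. degree \<omega> \<le> n}"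

lemma subspace_abelian_integrals: "subspace (abelian_integrals J x\<^sub>i x\<^sub>j n)"
proof -
  let ?A = "abelian_integral J x\<^sub>i x\<^sub>j"
  have z: "?A 0 = 0"
    by (auto simp: abelian_integral_def cpoly_0 fun_eq_iff)
  have a: "?A p + ?A q = ?A (p + q)" for p q
    by (auto simp: abelian_integral_def cpoly_add fun_eq_iff)
  have m: "c *\<^sub>R ?A p = ?A (smult c p)" for c p
    by (auto simp: abelian_integral_def cpoly_smult fun_eq_iff scaleR_fun_def scaleR_diff_right)
  have "0 \<in> abelian_integrals J x\<^sub>i x\<^sub>j n"
    unfolding abelian_integrals_def using z by (auto intro!: exI[of _ 0])
  moreover have "u + v \<in> abelian_integrals J x\<^sub>i x\<^sub>j n"
    if "u \<in> abelian_integrals J x\<^sub>i x\<^sub>j n" "v \<in> abelian_integrals J x\<^sub>i x\<^sub>j n" for u v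
    using that a by (fastforce simp: abelian_integrals_def intro: degree_add_le)
  moreover have "c *\<^sub>R u \<in> abelian_integrals J x\<^sub>i x\<^sub>j n"
    if "u \<in> abelian_integrals J x\<^sub>i x\<^sub>j n" for c u
    using that m degree_smult_le order_trans by (fastforce simp: abelian_integrals_def)
  ultimately show ?thesis by (simp add: subspace_def)
qed

text \<open>Here \<open>dim\<close> is the dimension over the reals.\<close>

definition chebyshev :: "real set \<Rightarrow> (real \<Rightarrow> complex) set \<Rightarrow> bool" where
  "chebyshev J V \<longleftrightarrow>
     (\<forall>I\<in>V. (\<exists>t\<in>J. I t \<noteq> 0) \<longrightarrow>
        finite {t\<in>J. I t = 0} \<and> int (card {t\<in>J. I t = 0}) \<le> int (dim V) - 1)"

end

theory Submission
  imports Defs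
begin

text \<open>
  For \<open>-1/4 < t < 0\<close> all roots of \<open>f0 = t\<close> are real, and two distinct roots satisfy \<open>x = - y\<close>
  or \<open>x\<^sup>2 + y\<^sup>2 = 1\<close>; by connectedness one alternative holds throughout the family. In the first
  case the integrals are \<open>2 x E(x\<^sup>2)\<close> with \<open>E\<close> an arbitrary polynomial, and root counting suffices.
  In the second, put \<open>v = (x + y)\<^sup>2\<close>, which determines \<open>t = - (v - 1)\<^sup>2 / 4\<close>. Then an integral equals
  \<open>(x - y) (E(v) \<plusminus> \<surd>v C(2 v - v\<^sup>2))\<close> with polynomials \<open>E\<close>, \<open>C\<close>.

  The zeros \<open>v > 0\<close> of \<open>E(v) + \<surd>v C(2 v - v\<^sup>2)\<close> are counted by a discrete form of Petrov's argument.
  Let \<open>M\<close> be a polynomial such that \<open>R = M C(2 v - v\<^sup>2)\<close> is nonnegative for \<open>v < 0\<close>. If there were too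
  many zeros, the divided difference of \<open>\<surd>v R\<close> over them would equal that of \<open>- M E\<close>, which
  vanishes by degree. But up to sign and scale it is the integral over \<open>y > 0\<close> of
  \<open>y\<^sup>2 R(- y\<^sup>2) / \<Prod>(y\<^sup>2 + v)\<close>, the product being over the zeros, so \<open>R = 0\<close>.
\<close>

section \<open>Divided differences\<close>

lemma lagrange_interpolation:
  fixes p :: "'a::field poly"
  assumes "finite Z" "degree p < card Z"
  shows "p = (\<Sum>v\<in>Z. smult (poly p v / (\<Prod>u\<in>Z - {v}. v - u)) (\<Prod>u\<in>Z - {v}. [:- u, 1:]))"
    (is "p = ?q")
proof (rule poly_eqI_degree)
  show "poly p w = poly ?q w" if "w \<in> Z" for w
  proof -
    have "poly ?q w = (\<Sum>v\<in>Z. if v = w then poly p w else 0)"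
      unfolding poly_sum
    proof (rule sum.cong)
      fix v assume "v \<in> Z"
      show "poly (smult (poly p v / (\<Prod>u\<in>Z - {v}. v - u)) (\<Prod>u\<in>Z - {v}. [:- u, 1:])) w
          = (if v = w then poly p w else 0)"
      proof (cases "v = w")
        case True
        have "(\<Prod>u\<in>Z - {v}. v - u) \<noteq> 0"
          using assms(1) by simp
        with True show ?thesis by (simp add: poly_prod)
      next
        case False
        then have "(\<Prod>u\<in>Z - {v}. w - u) = 0"
          using assms(1) that by (intro prod_zero) auto
        with False show ?thesis by (simp add: poly_prod)
      qed
    qed simp
    with that assms(1) show ?thesis by simp
  qed
  have "degree (\<Prod>u\<in>Z - {v}. [:- u, 1:]) \<le> card Z - 1" if "v \<in> Z" for v
    using degree_prod_sum_le[of "Z - {v}" "\<lambda>u. [:- u, 1:]"] assms(1) that by simp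
  then have "degree ?q \<le> card Z - 1"
    by (intro degree_sum_le) (use assms in \<open>auto intro: order_trans[OF degree_smult_le]\<close>)
  with assms show "degree ?q < card Z" by linarith
qed (use assms in auto)

text \<open>Comparing coefficients at \<open>card Z - 1\<close> in the Lagrange formula, the sum is
  that coefficient of \<open>p\<close>, which lies above the degree.\<close>

lemma divided_difference_eq_0:
  fixes p :: "'a::field poly"
  assumes "finite Z" "degree p + 1 < card Z"
  shows "(\<Sum>v\<in>Z. poly p v / (\<Prod>u\<in>Z - {v}. v - u)) = 0"
proof -
  have "coeff (\<Prod>u\<in>Z - {v}. [:- u, 1:]) (card Z - 1) = 1" if "v \<in> Z" for v
  proof -
    have "degree (\<Prod>u\<in>Z - {v}. [:- u, 1:]) = card Z - 1"
      using assms that by (subst degree_prod_eq_sum_degree) auto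
    moreover have "lead_coeff (\<Prod>u\<in>Z - {v}. [:- u, 1:]) = 1"
      by (simp add: lead_coeff_prod)
    ultimately show ?thesis by simp
  qed
  then have "(\<Sum>v\<in>Z. poly p v / (\<Prod>u\<in>Z - {v}. v - u)) = coeff p (card Z - 1)"
    using assms by (subst (2) lagrange_interpolation[of Z p]) (auto simp: coeff_sum)
  also have "\<dots> = 0"
    using assms by (intro coeff_eq_0) simp
  finally show ?thesis .
qed

lemma partial_fractions:
  fixes p :: "'a::field poly"
  assumes "finite Z" "degree p < card Z" "x \<notin> Z"
  shows "poly p x / (\<Prod>v\<in>Z. x - v) = (\<Sum>v\<in>Z. poly p v / (\<Prod>u\<in>Z - {v}. v - u) / (x - v))"
proof -
  have "poly p x = (\<Sum>v\<in>Z. poly p v / (\<Prod>u\<in>Z - {v}. v - u) * (\<Prod>u\<in>Z - {v}. x - u))"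
    by (subst lagrange_interpolation[OF assms(1,2)]) (simp add: poly_sum poly_prod)
  then have "poly p x / (\<Prod>v\<in>Z. x - v)
      = (\<Sum>v\<in>Z. poly p v / (\<Prod>u\<in>Z - {v}. v - u) * ((\<Prod>u\<in>Z - {v}. x - u) / (\<Prod>v\<in>Z. x - v)))"
    by (simp add: sum_divide_distrib)
  also have "\<dots> = (\<Sum>v\<in>Z. poly p v / (\<Prod>u\<in>Z - {v}. v - u) / (x - v))"
  proof (rule sum.cong)
    fix v assume "v \<in> Z"
    then have "(\<Prod>u\<in>Z. x - u) = (x - v) * (\<Prod>u\<in>Z - {v}. x - u)"
      using assms(1) by (rule prod.remove[rotated])
    moreover have "(\<Prod>u\<in>Z - {v}. x - u) \<noteq> 0"
      using assms(1,3) by auto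
    ultimately show "poly p v / (\<Prod>u\<in>Z - {v}. v - u) * ((\<Prod>u\<in>Z - {v}. x - u) / (\<Prod>v\<in>Z. x - v))
        = poly p v / (\<Prod>u\<in>Z - {v}. v - u) / (x - v)"
      by simp
  qed simp
  finally show ?thesis .
qed

text \<open>Partial fractions turn x R(x) / prod (x - v), taken at x = -y^2, into a sum of multiples
  of 1 / (y^2 + v). Integrated termwise over y > 0 these give arctangents, with total pi/2 times the
  divided difference in \<open>dd\<close>. So an integrand of constant sign has integral 0 and must
  vanish.\<close>

lemma divided_difference_sqrt_eq_0_imp_eq_0:
  fixes R :: "real poly"
  assumes Z: "finite Z" "Z \<subseteq> {0<..}" and deg: "degree R + 1 < card Z"
    and nonneg: "\<And>x. x > 0 \<Longrightarrow> poly R (- x) \<ge> 0"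
    and dd: "(\<Sum>v\<in>Z. sqrt v * poly R v / (\<Prod>u\<in>Z - {v}. v - u)) = 0"
  shows "R = 0"
proof -
  define w where "w v = (\<Prod>u\<in>Z - {v}. v - u)" for v
  \<comment> \<open>\<open>\<Phi>\<close> is the primitive of \<open>h\<close> with \<open>\<Phi> 0 = 0\<close>, and by \<open>dd\<close> it tends to \<open>0\<close> at infinity.\<close>
  define h where "h y = (\<Sum>v\<in>Z. v * poly R v / w v / (y\<^sup>2 + v))" for y
  define \<Phi> where "\<Phi> y = (\<Sum>v\<in>Z. sqrt v * poly R v / w v * arctan (y / sqrt v))" for y
  \<comment> \<open>The sign that appears when each factor -y^2 - v is replaced by y^2 + v.\<close>
  define \<epsilon> :: real where "\<epsilon> = (- 1) ^ card Z"
  have eps: "\<epsilon> * \<epsilon> = 1" by (simp add: \<epsilon>_def flip: power_mult_distrib)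
  have pos: "v > 0" if "v \<in> Z" for v using Z that by auto
  have h_eq: "\<epsilon> * h y = y\<^sup>2 * poly R (- (y\<^sup>2)) / (\<Prod>v\<in>Z. y\<^sup>2 + v)" for y
  proof -
    have nz: "- (y\<^sup>2) \<notin> Z" using pos[of "- (y\<^sup>2)"] by auto
    \<comment> \<open>\<open>pCons 0 R\<close> is x R(x); the extra factor x matches the derivative
      v / (y^2 + v) of sqrt v * arctan (y / sqrt v).\<close>
    have d: "degree (pCons 0 R) < card Z" using deg degree_pCons_le[of 0 R] by simp
    have "h y = - (\<Sum>v\<in>Z. poly (pCons 0 R) v / w v / (- (y\<^sup>2) - v))"
      unfolding h_def sum_negf[symmetric]
    proof (rule sum.cong)
      fix v assume "v \<in> Z"
      have "- (y\<^sup>2) - v = - (y\<^sup>2 + v)" by simp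
      then show "v * poly R v / w v / (y\<^sup>2 + v) = - (poly (pCons 0 R) v / w v / (- (y\<^sup>2) - v))"
        by (simp only: divide_minus_right) simp
    qed simp
    also have "\<dots> = - (poly (pCons 0 R) (- (y\<^sup>2)) / (\<Prod>v\<in>Z. - (y\<^sup>2) - v))"
      using partial_fractions[OF Z(1) d nz] by (simp add: w_def)
    also have "(\<Prod>v\<in>Z. - (y\<^sup>2) - v) = \<epsilon> * (\<Prod>v\<in>Z. y\<^sup>2 + v)"
      unfolding \<epsilon>_def by (subst prod_constant[symmetric], subst prod.distrib[symmetric]) simp
    finally have "h y = y\<^sup>2 * poly R (- (y\<^sup>2)) / (\<epsilon> * (\<Prod>v\<in>Z. y\<^sup>2 + v))" by simp
    moreover have "\<epsilon> = 1 \<or> \<epsilon> = - 1" using eps square_eq_1_iff by blast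
    ultimately show ?thesis by auto
  qed
  have h_nonneg: "\<epsilon> * h y \<ge> 0" if "y \<ge> 0" for y
  proof (cases "y = 0")
    case False
    then have "poly R (- (y\<^sup>2)) \<ge> 0" by (intro nonneg) simp
    then show ?thesis unfolding h_eq
      by (intro divide_nonneg_nonneg mult_nonneg_nonneg prod_nonneg add_nonneg_nonneg)
        (auto dest: pos)
  qed (simp add: h_eq)
  have deriv: "(\<Phi> has_real_derivative h y) (at y)" for y
    unfolding \<Phi>_def h_def
  proof (rule DERIV_sum)
    fix v assume "v \<in> Z"
    then have v: "v > 0" by (rule pos)
    have "inverse (1 + (y / sqrt v)\<^sup>2) = v / (y\<^sup>2 + v)"
      using v by (simp add: power_divide divide_simps)
    moreover have "((\<lambda>y. y / sqrt v) has_real_derivative 1 / sqrt v) (at y)"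
      by (rule DERIV_cdivide) (rule DERIV_ident)
    ultimately have "((\<lambda>y. arctan (y / sqrt v)) has_real_derivative v / (y\<^sup>2 + v) * (1 / sqrt v)) (at y)"
      using DERIV_chain2[OF DERIV_arctan, of "\<lambda>y. y / sqrt v"] by metis
    from DERIV_cmult[OF this, of "sqrt v * poly R v / w v"]
    show "((\<lambda>y. sqrt v * poly R v / w v * arctan (y / sqrt v)) has_real_derivative
        v * poly R v / w v / (y\<^sup>2 + v)) (at y)"
      using v by (simp add: divide_simps mult.commute)
  qed
  have mono: "\<epsilon> * \<Phi> x \<le> \<epsilon> * \<Phi> y" if "0 \<le> x" "x \<le> y" for x y
  proof (rule DERIV_nonneg_imp_nondecreasing[OF that(2)])
    fix z assume "x \<le> z" "z \<le> y"
    then show "\<exists>d. ((\<lambda>y. \<epsilon> * \<Phi> y) has_real_derivative d) (at z) \<and> 0 \<le> d"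
      using h_nonneg[of z] that by (intro exI[of _ "\<epsilon> * h z"] conjI DERIV_cmult deriv) auto
  qed
  have lim: "((\<lambda>y. \<epsilon> * \<Phi> y) \<longlongrightarrow> 0) at_top"
  proof -
    have "(\<Phi> \<longlongrightarrow> (\<Sum>v\<in>Z. sqrt v * poly R v / w v * (pi / 2))) at_top"
      unfolding \<Phi>_def
    proof (intro tendsto_intros)
      fix v assume "v \<in> Z"
      then have "filterlim (\<lambda>y. y / sqrt v) at_top at_top"
        using pos by (intro filterlim_at_top_mult_tendsto_pos[where c = "1 / sqrt v", 
              of "\<lambda>_. 1 / sqrt v" _ "\<lambda>y. y", simplified] filterlim_ident) auto
      then show "((\<lambda>y. arctan (y / sqrt v)) \<longlongrightarrow> pi / 2) at_top"
        by (rule filterlim_compose[OF tendsto_arctan_at_top])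
    qed
    also have "(\<Sum>v\<in>Z. sqrt v * poly R v / w v * (pi / 2)) = 0"
      using dd by (simp only: w_def flip: sum_distrib_right mult_zero_left)
    finally show ?thesis using tendsto_mult_right_zero by blast
  qed
  \<comment> \<open>A nondecreasing function that starts at 0 and tends to 0 is constantly 0, so its
    derivative vanishes as well; this gives R infinitely many roots.\<close>
  have Phi_0: "\<epsilon> * \<Phi> x = 0" if "x \<ge> 0" for x
  proof (rule antisym)
    show "\<epsilon> * \<Phi> x \<le> 0"
      using that by (intro tendsto_lowerbound[OF lim] eventually_mono[OF eventually_ge_at_top[of x]] mono) auto
    have "\<Phi> 0 = 0" by (simp add: \<Phi>_def)
    then show "0 \<le> \<epsilon> * \<Phi> x" using mono[of 0 x] that by simp
  qed
  have R0: "poly R (- (y\<^sup>2)) = 0" if "y > 0" for y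
  proof -
    have "((\<lambda>y. \<epsilon> * \<Phi> y) has_real_derivative 0) (at y)"
      by (rule has_field_derivative_transform_within_open[of "\<lambda>_. 0" _ _ "{0<..}"])
        (use that Phi_0 in auto)
    then have "\<epsilon> * h y = 0"
      using DERIV_unique DERIV_cmult[OF deriv] by blast
    moreover have "(\<Prod>v\<in>Z. y\<^sup>2 + v) \<noteq> 0"
      using Z(1) pos by (auto simp: add_nonneg_eq_0_iff dest: pos)
    ultimately show ?thesis using h_eq[of y] that by simp
  qed
  have "{..<0} \<subseteq> {x. poly R x = 0}"
  proof
    fix x :: real assume "x \<in> {..<0}"
    then show "x \<in> {x. poly R x = 0}" using R0[of "sqrt (- x)"] by simp
  qed
  then show ?thesis
    using finite_subset poly_roots_finite infinite_Iio by blast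
qed

section \<open>Positive zeros of \<open>E(v) + \<surd>v C(2 v - v\<^sup>2)\<close>\<close>

text \<open>\<open>v \<mapsto> 2 v - v\<^sup>2\<close> is an increasing bijection of the negative half-line, so each sign change
  of \<open>C\<close> there costs only one linear factor in \<open>v\<close>.\<close>
lemma sign_fixing_multiplier:
  fixes C :: "real poly"
  assumes "C \<noteq> 0"
  shows "\<exists>M. M \<noteq> 0 \<and> degree M \<le> degree C \<and> (\<forall>v<0. poly C (2 * v - v\<^sup>2) * poly M v \<ge> 0)"
  using assms
proof (induction "degree C" arbitrary: C rule: less_induct)
  case less
  have neg: "2 * v - v\<^sup>2 < 0" if "v < 0" for v :: real
    using that zero_le_power2[of v] by linarith
  show ?case
  proof (cases "\<exists>s<0. poly C s = 0")
    case True
    then obtain s where s: "s < 0" "poly C s = 0" by blast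
    then obtain C' where C': "C = [:- s, 1:] * C'"
      by (auto simp: poly_eq_0_iff_dvd elim: dvdE)
    with less.prems have nz: "C' \<noteq> 0" by auto
    then have deg: "degree C = Suc (degree C')"
      unfolding C' by (subst degree_mult_eq) auto
    then obtain M where M: "M \<noteq> 0" "degree M \<le> degree C'"
      "\<And>v. v < 0 \<Longrightarrow> poly C' (2 * v - v\<^sup>2) * poly M v \<ge> 0"
      using less.hyps[of C'] nz by auto
    \<comment> \<open>The negative preimage of s under v -> 2 v - v^2.\<close>
    define \<xi> where "\<xi> = 1 - sqrt (1 - s)"
    have xi: "\<xi> < 0" "2 * \<xi> - \<xi>\<^sup>2 = s"
      using s by (auto simp: \<xi>_def power2_eq_square algebra_simps)
    show ?thesis
    proof (intro exI[of _ "[:- \<xi>, 1:] * M"] conjI allI impI)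
      show "[:- \<xi>, 1:] * M \<noteq> 0"
        using M(1) by (simp only: mult_eq_0_iff) simp
      show "degree ([:- \<xi>, 1:] * M) \<le> degree C"
        using M deg by (subst degree_mult_eq) auto
      fix v :: real assume v: "v < 0"
      \<comment> \<open>The factor 2 v - v^2 - s of C splits as (v - \<xi>) (2 - v - \<xi>). Its
        second factor is positive, and the new factor of the multiplier completes the first one to a
        square.\<close>
      have "poly C (2 * v - v\<^sup>2) * poly ([:- \<xi>, 1:] * M) v
          = (2 - v - \<xi>) * (v - \<xi>)\<^sup>2 * (poly C' (2 * v - v\<^sup>2) * poly M v)"
        unfolding C' xi(2)[symmetric] by (simp add: power2_eq_square algebra_simps)
      also have "\<dots> \<ge> 0" using v xi(1) by (intro mult_nonneg_nonneg[OF _ M(3)[OF v]]) auto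
      finally show "0 \<le> poly C (2 * v - v\<^sup>2) * poly ([:- \<xi>, 1:] * M) v" .
    qed
  next
    case False
    \<comment> \<open>Without negative roots C keeps the sign of C(-1) on the negative half-line, so
      the constant C(-1) serves as multiplier.\<close>
    have sgn: "0 \<le> poly C s * poly C (- 1)" if "s < 0" for s
    proof (rule ccontr)
      assume opp: "\<not> ?thesis"
      then have "s \<noteq> - 1" by auto
      with opp obtain r where "r < max s (- 1)" "poly C r = 0"
        using poly_IVT[of s "- 1" C] poly_IVT[of "- 1" s C]
        by (cases "s < - 1") (auto simp: not_le mult.commute)
      with False \<open>s < 0\<close> show False by auto
    qed
    have "poly C (- 1) \<noteq> 0" using False by auto
    then show ?thesis
      using sgn[OF neg] by (intro exI[of _ "[:poly C (- 1):]"]) simp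
  qed
qed

text \<open>For nonzero C the multiplier M has degree at most deg C, so R = M C(2 v - v^2) has
  degree at most 3 deg C and M E at most deg C + deg E. The two inequalities in the hypothesis on C
  are what the two divided difference lemmas then require. Once C = 0, E has more roots than its
  degree.\<close>

lemma few_positive_zeros:
  fixes E C :: "real poly"
  assumes Z: "finite Z" "Z \<subseteq> {0<..}"
    and zero: "\<And>v. v \<in> Z \<Longrightarrow> poly E v + sqrt v * poly C (2 * v - v\<^sup>2) = 0"
    and E: "degree E < card Z"
    and C: "C = 0 \<or> degree E + degree C + 1 < card Z \<and> 3 * degree C + 1 < card Z"
  shows "E = 0 \<and> C = 0"
proof -
  have "C = 0"
  proof (rule ccontr)
    assume nz: "C \<noteq> 0"
    then obtain M where M: "M \<noteq> 0" "degree M \<le> degree C"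
      "\<And>v. v < 0 \<Longrightarrow> poly C (2 * v - v\<^sup>2) * poly M v \<ge> 0"
      using sign_fixing_multiplier by blast
    define R where "R = M * pcompose C [:0, 2, - 1:]"
    have R: "poly R v = poly M v * poly C (2 * v - v\<^sup>2)" for v
      by (simp add: R_def poly_pcompose power2_eq_square algebra_simps)
    have "pcompose C [:0, 2, - 1:] \<noteq> 0"
      using nz by (simp add: pcompose_eq_0_iff)
    then have "R \<noteq> 0" using M by (simp add: R_def)
    moreover have "R = 0"
    proof (rule divided_difference_sqrt_eq_0_imp_eq_0[OF Z])
      have "degree R \<le> degree M + degree C * 2"
        unfolding R_def by (rule order_trans[OF degree_mult_le]) (simp add: degree_pcompose)
      then show "degree R + 1 < card Z" using M C nz by linarith
      show "poly R (- x) \<ge> 0" if "x > 0" for x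
        using M(3)[of "- x"] that by (simp add: R mult.commute)
      have "sqrt v * poly R v = - poly (M * E) v" if "v \<in> Z" for v
      proof -
        have "sqrt v * poly C (2 * v - v\<^sup>2) = - poly E v" using zero[OF that] by linarith
        then show ?thesis by (simp add: R mult.left_commute[of "sqrt v"])
      qed
      then have "(\<Sum>v\<in>Z. sqrt v * poly R v / (\<Prod>u\<in>Z - {v}. v - u))
          = - (\<Sum>v\<in>Z. poly (M * E) v / (\<Prod>u\<in>Z - {v}. v - u))"
        by (simp flip: sum_negf)
      also have "(\<Sum>v\<in>Z. poly (M * E) v / (\<Prod>u\<in>Z - {v}. v - u)) = 0"
        using degree_mult_le[of M E] M C nz by (intro divided_difference_eq_0 Z) linarith
      finally show "(\<Sum>v\<in>Z. sqrt v * poly R v / (\<Prod>u\<in>Z - {v}. v - u)) = 0" by simp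
    qed
    ultimately show False by contradiction
  qed
  moreover from this have "E = 0"
    using zero E by (intro poly_eqI_degree[of Z E 0]) simp_all
  ultimately show ?thesis by simp
qed

section \<open>Abelian integrals\<close>

text \<open>Among the terms with nonzero coefficient, the one of largest degree has a leading term
  that no other term can cancel.\<close>

lemma smult_sum_eq_0_distinct_degrees:
  fixes P :: "'i \<Rightarrow> 'a::idom poly"
  assumes "finite A" "inj_on (\<lambda>i. degree (P i)) A" "\<And>i. i \<in> A \<Longrightarrow> P i \<noteq> 0"
    and zero: "(\<Sum>i\<in>A. smult (c i) (P i)) = 0" and "i \<in> A"
  shows "c i = 0"
proof (rule ccontr)
  assume "c i \<noteq> 0"
  define B where "B = {i\<in>A. c i \<noteq> 0}"
  have "finite B" "B \<noteq> {}" using assms \<open>c i \<noteq> 0\<close> by (auto simp: B_def)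
  then have "Max ((\<lambda>i. degree (P i)) ` B) \<in> (\<lambda>i. degree (P i)) ` B"
    by (intro Max_in) auto
  then obtain k where k: "k \<in> B" and "degree (P k) = Max ((\<lambda>i. degree (P i)) ` B)"
    by auto
  then have max: "degree (P l) \<le> degree (P k)" if "l \<in> B" for l
    using \<open>finite B\<close> that by simp
  have "c l * coeff (P l) (degree (P k)) = 0" if "l \<in> A" "l \<noteq> k" for l
  proof (cases "l \<in> B")
    case True
    then have "degree (P l) \<noteq> degree (P k)"
      using that k assms(2) by (auto simp: B_def inj_on_def)
    then show ?thesis using max[OF True] by (simp add: coeff_eq_0)
  qed (use that in \<open>simp add: B_def\<close>)
  then have "(\<Sum>i\<in>A - {k}. c i * coeff (P i) (degree (P k))) = 0"
    by (intro sum.neutral) blast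
  moreover have "k \<in> A" using k by (simp add: B_def)
  ultimately have "(\<Sum>i\<in>A. c i * coeff (P i) (degree (P k))) = c k * lead_coeff (P k)"
    using assms(1) by (simp add: sum.remove[of A k])
  moreover have "(\<Sum>i\<in>A. c i * coeff (P i) (degree (P k))) = 0"
    using arg_cong[OF zero, of "\<lambda>p. coeff p (degree (P k))"] by (simp add: coeff_sum)
  ultimately show False using k assms(3) by (auto simp: B_def)
qed

lemma poly_eq_sum_monoms:
  fixes p :: "'a::comm_semiring_1 poly"
  assumes "degree p \<le> n"
  shows "poly p x = (\<Sum>k\<le>n. coeff p k * x ^ k)"
  by (subst poly_as_sum_of_monoms'[OF assms, symmetric]) (simp add: poly_sum poly_monom)

lemma cpoly_of_real: "cpoly p (of_real x) = of_real (poly p x)"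
  by (induction p) (simp_all add: cpoly_def map_poly_pCons)

lemma abelian_integral_sum_monoms:
  assumes "finite K"
  shows "abelian_integral J x y (\<Sum>k\<in>K. monom (c k) k)
    = (\<Sum>k\<in>K. c k *\<^sub>R abelian_integral J x y (monom 1 k))"
  using assms
proof (induction K)
  case empty
  show ?case by (simp add: abelian_integral_def cpoly_0 fun_eq_iff)
next
  case (insert k K)
  have "abelian_integral J x y (monom (c k) k + q)
      = c k *\<^sub>R abelian_integral J x y (monom 1 k) + abelian_integral J x y q" for q
    by (auto simp: abelian_integral_def cpoly_add cpoly_monom fun_eq_iff scaleR_fun_def
        scaleR_conv_of_real algebra_simps)
  with insert show ?case by simp
qed

text \<open>The monomials with exponents in \<open>K\<close> have linearly independent integrals, so
  \<open>card K\<close> is a lower bound for the dimension. An integral that is not identically zero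
  has fewer than \<open>card K\<close> zeros, hence fewer than the dimension.\<close>

lemma chebyshev_abelian_integralsI:
  assumes K: "K \<subseteq> {..n}"
    and indep: "\<And>\<omega>. degree \<omega> \<le> n \<Longrightarrow> (\<And>k. k \<notin> K \<Longrightarrow> coeff \<omega> k = 0) \<Longrightarrow>
      (\<forall>t\<in>J. abelian_integral J x y \<omega> t = 0) \<Longrightarrow> \<omega> = 0"
    and zeros: "\<And>\<omega> T. degree \<omega> \<le> n \<Longrightarrow> finite T \<Longrightarrow> T \<subseteq> J \<Longrightarrow> card T = card K \<Longrightarrow>
      (\<forall>t\<in>T. abelian_integral J x y \<omega> t = 0) \<Longrightarrow> (\<forall>t\<in>J. abelian_integral J x y \<omega> t = 0)"
  shows "chebyshev J (abelian_integrals J x y n)"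
proof -
  define V where "V = abelian_integrals J x y n"
  define b where "b k = abelian_integral J x y (monom 1 k)" for k
  have fin: "finite K" using K finite_subset by blast
  have b_in: "b k \<in> V" if "k \<le> n" for k
    using that degree_monom_le[of "1 :: real" k]
    unfolding b_def V_def abelian_integrals_def by fastforce
  have comb: "c k = 0" if "(\<Sum>k\<in>K. c k *\<^sub>R b k) = 0" "k \<in> K" for c k
  proof -
    let ?\<omega> = "\<Sum>k\<in>K. monom (c k) k"
    have coeff: "coeff ?\<omega> l = (if l \<in> K then c l else 0)" for l
      using fin by (simp add: coeff_sum sum.delta)
    have "?\<omega> = 0"
    proof (rule indep)
      show "degree ?\<omega> \<le> n"
        using fin K by (intro degree_sum_le) (auto intro: order_trans[OF degree_monom_le])
      show "\<forall>t\<in>J. abelian_integral J x y ?\<omega> t = 0"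
        using that(1) by (simp add: abelian_integral_sum_monoms[OF fin] b_def)
    qed (simp add: coeff)
    with coeff[of k] that(2) show ?thesis by simp
  qed
  have inj: "inj_on b K"
  proof (rule inj_onI, rule ccontr)
    fix k l assume kl: "k \<in> K" "l \<in> K" "b k = b l" "k \<noteq> l"
    have "(\<Sum>m\<in>K. (if m = k then 1 else if m = l then - 1 else 0) *\<^sub>R b m)
        = (\<Sum>m\<in>K. (if m = k then b k else 0) + (if m = l then - b l else 0))"
      using kl(4) by (intro sum.cong) auto
    also have "\<dots> = 0"
      using kl fin by (simp add: sum.distrib)
    finally show False using comb[of "\<lambda>m. if m = k then 1 else if m = l then - 1 else 0" k] kl by simp
  qed
  have "independent (b ` K)"
  proof (rule independent_if_scalars_zero)
    fix c v assume "(\<Sum>v\<in>b ` K. c v *\<^sub>R v) = 0" "v \<in> b ` K"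
    then show "c v = 0"
      using comb[of "\<lambda>k. c (b k)"] by (auto simp: sum.reindex[OF inj])
  qed (use fin in simp)
  \<comment> \<open>A finite spanning set makes the basis \<open>B\<close> below finite; for an
    infinite one \<open>card B\<close> would be 0 and say nothing about the size of V.\<close>
  have V_span: "V \<subseteq> span (b ` {..n})"
  proof
    fix I assume "I \<in> V"
    then obtain \<omega> where \<omega>: "degree \<omega> \<le> n" "I = abelian_integral J x y \<omega>"
      unfolding V_def abelian_integrals_def by blast
    have I: "I = (\<Sum>k\<le>n. coeff \<omega> k *\<^sub>R b k)"
      unfolding \<omega>(2) b_def
      by (subst poly_as_sum_of_monoms'[OF \<omega>(1), symmetric]) (rule abelian_integral_sum_monoms, simp)
    show "I \<in> span (b ` {..n})"
      unfolding I by (intro span_sum span_scale) (simp add: span_base)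
  qed
  obtain B where B: "B \<subseteq> V" "independent B" "V \<subseteq> span B" "card B = dim V"
    by (rule basis_exists)
  have "finite B"
    using independent_span_bound[of "b ` {..n}" B] B V_span by auto
  then have "card (b ` K) \<le> card B"
    using independent_span_bound[of B "b ` K"] \<open>independent (b ` K)\<close> B b_in K by blast
  then have dim: "card K \<le> dim V"
    using B card_image[OF inj] by simp
  have few: "finite {t\<in>J. I t = 0} \<and> card {t\<in>J. I t = 0} < card K"
    if I: "I \<in> V" "\<exists>t\<in>J. I t \<noteq> 0" for I
  proof (rule ccontr)
    assume many: "\<not> ?thesis"
    have "\<exists>T. T \<subseteq> {t\<in>J. I t = 0} \<and> finite T \<and> card T = card K"
    proof (cases "finite {t\<in>J. I t = 0}")
      case True
      with many show ?thesis
        using obtain_subset_with_card_n[of "card K" "{t\<in>J. I t = 0}"] by force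
    next
      case False
      from infinite_arbitrarily_large[OF this, of "card K"] show ?thesis by blast
    qed
    then obtain T where T: "T \<subseteq> {t\<in>J. I t = 0}" "finite T" "card T = card K" by blast
    obtain \<omega> where \<omega>: "degree \<omega> \<le> n" "I = abelian_integral J x y \<omega>"
      using I(1) unfolding V_def abelian_integrals_def by blast
    have "\<forall>t\<in>J. I t = 0"
      unfolding \<omega>(2) using T by (intro zeros[OF \<omega>(1) T(2)]) (auto simp: \<omega>(2))
    with I(2) show False by blast
  qed
  show ?thesis
    unfolding chebyshev_def V_def[symmetric]
  proof (intro ballI impI)
    fix I assume "I \<in> V" "\<exists>t\<in>J. I t \<noteq> 0"
    from few[OF this] have "finite {t\<in>J. I t = 0}" "card {t\<in>J. I t = 0} < dim V"
      using dim by (auto intro: less_le_trans)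
    then show "finite {t\<in>J. I t = 0} \<and> int (card {t\<in>J. I t = 0}) \<le> int (dim V) - 1" by simp
  qed
qed

section \<open>The fibres over (-1/4, 0)\<close>

lemma cpoly_f0: "cpoly f0 z = z ^ 4 - z ^ 2"
  by (simp add: f0_def cpoly_diff cpoly_monom)

text \<open>Completing the square gives (z^2 - 1/2)^2 = t + 1/4, which lies strictly between 0 and
  1/4. So z^2 is 1/2 + r or 1/2 - r with 0 <= r < 1/2, a positive real in both cases.\<close>

lemma f0_fibre_real:
  assumes "cpoly f0 z = of_real t" "-1/4 < t" "t < 0"
  shows "z = of_real (Re z)" "Re z ^ 4 - Re z ^ 2 = t"
proof -
  define r where "r = sqrt (t + 1 / 4)"
  have r: "r\<^sup>2 = t + 1 / 4" "0 \<le> r" using assms(2) by (simp_all add: r_def)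
  have "r\<^sup>2 < (1 / 2)\<^sup>2" unfolding r(1) using assms(3) by (simp add: power2_eq_square)
  then have "r < 1 / 2" by (rule power2_less_imp_less) simp
  have "(z\<^sup>2 - 1 / 2)\<^sup>2 = (z ^ 4 - z ^ 2) + 1 / 4"
    by (simp add: power2_eq_square power4_eq_xxxx algebra_simps)
  also have "\<dots> = of_real (r\<^sup>2)"
    unfolding r(1) cpoly_f0[symmetric] assms(1) by simp
  finally have "(z\<^sup>2 - 1 / 2)\<^sup>2 = (of_real r)\<^sup>2" by simp
  then have "z\<^sup>2 - 1 / 2 = of_real r \<or> z\<^sup>2 - 1 / 2 = - of_real r"
    by (simp add: power2_eq_iff)
  then have "z\<^sup>2 = of_real (1 / 2 + r) \<or> z\<^sup>2 = of_real (1 / 2 - r)"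
    by (simp only: diff_eq_eq) (simp add: add.commute)
  moreover have "1 / 2 + r > 0" "1 / 2 - r > 0" using r \<open>r < 1 / 2\<close> by simp_all
  ultimately obtain u where u: "u > 0" "z\<^sup>2 = of_real u" by metis
  have "of_real u = (of_real (sqrt u) :: complex)\<^sup>2"
    using u(1) by (subst of_real_power[symmetric]) simp
  then have "z\<^sup>2 = (of_real (sqrt u))\<^sup>2" using u(2) by (rule trans[rotated])
  then have "z = of_real (sqrt u) \<or> z = of_real (- sqrt u)"
    by (simp add: power2_eq_iff)
  then obtain x where x: "z = of_real x" by blast
  then show "z = of_real (Re z)" by simp
  have "of_real (x ^ 4 - x ^ 2) = (of_real t :: complex)"
    using assms(1) unfolding x by (simp add: cpoly_f0)
  then have "x ^ 4 - x ^ 2 = t" by (simp only: of_real_eq_iff)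
  then show "Re z ^ 4 - Re z ^ 2 = t" by (simp add: x)
qed

section \<open>Power differences on the circle x^2 + y^2 = 1\<close>

text \<open>
  If \<open>x\<^sup>2 + y\<^sup>2 = 1\<close> and \<open>v = (x + y)\<^sup>2\<close>, then \<open>x\<close> and \<open>y\<close> are roots of
  \<open>z\<^sup>4 = z\<^sup>2 - (v - 1)\<^sup>2 / 4\<close>; both recursions are this relation, the second one in the
  variable \<open>s = 2 v - v\<^sup>2\<close>, for which \<open>(v - 1)\<^sup>2 = 1 - s\<close>.
\<close>

fun odd_quot :: "nat \<Rightarrow> real poly" where
  "odd_quot 0 = 1"
| "odd_quot (Suc 0) = [:1 / 2, 1 / 2:]"
| "odd_quot (Suc (Suc i)) = odd_quot (Suc i) + [:- 1 / 4, 1 / 2, - 1 / 4:] * odd_quot i"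

fun even_quot :: "nat \<Rightarrow> real poly" where
  "even_quot 0 = 1"
| "even_quot (Suc 0) = 1"
| "even_quot (Suc (Suc i)) = even_quot (Suc i) + [:- 1 / 4, 1 / 4:] * even_quot i"

lemma power_diff_step:
  fixes x y :: real
  assumes "x\<^sup>2 + y\<^sup>2 = 1"
  shows "x ^ (k + 4) - y ^ (k + 4) = (x ^ (k + 2) - y ^ (k + 2)) - ((x + y)\<^sup>2 - 1)\<^sup>2 / 4 * (x ^ k - y ^ k)"
proof -
  have v: "((x + y)\<^sup>2 - 1)\<^sup>2 / 4 = x\<^sup>2 * y\<^sup>2"
  proof -
    have "(x + y)\<^sup>2 - 1 = 2 * (x * y)"
      using assms by (simp add: power2_eq_square algebra_simps)
    then show ?thesis by (simp add: power_mult_distrib)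
  qed
  have y: "y\<^sup>2 = 1 - x\<^sup>2" and x: "x\<^sup>2 = 1 - y\<^sup>2" using assms by simp_all
  have "x ^ 4 = x\<^sup>2 - x\<^sup>2 * y\<^sup>2"
    unfolding y by (simp add: power2_eq_square power4_eq_xxxx algebra_simps)
  moreover have "y ^ 4 = y\<^sup>2 - x\<^sup>2 * y\<^sup>2"
    unfolding x by (simp add: power2_eq_square power4_eq_xxxx algebra_simps)
  ultimately show ?thesis
    unfolding v power_add[of _ k] by (simp only: ring_distribs mult.commute[of "x\<^sup>2 * y\<^sup>2"])
qed

text \<open>The quotient for i = 1 is x^2 + x y + y^2 = 1 + (v - 1) / 2. It is not a polynomial in 2
  v - v^2, so the odd quotients are written in v itself.\<close>

lemma odd_power_diff:
  fixes x y :: real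
  assumes "x\<^sup>2 + y\<^sup>2 = 1"
  shows "x ^ (2 * i + 1) - y ^ (2 * i + 1) = (x - y) * poly (odd_quot i) ((x + y)\<^sup>2)"
proof (induction i rule: odd_quot.induct)
  case 2
  have "x ^ 3 - y ^ 3 = (x - y) * (x\<^sup>2 + y\<^sup>2 + x * y)"
    by (simp add: power2_eq_square power3_eq_cube algebra_simps)
  moreover have "x * y = ((x + y)\<^sup>2 - 1) / 2"
    using assms by (simp add: power2_eq_square algebra_simps)
  ultimately show ?case using assms by (simp add: numeral_3_eq_3 field_simps)
next
  case (3 i)
  have e: "2 * Suc (Suc i) + 1 = 2 * i + 1 + 4" "2 * i + 1 + 2 = 2 * Suc i + 1" by simp_all
  define v where "v = (x + y)\<^sup>2"
  have v: "(v - 1)\<^sup>2 / 4 = - (- (1 / 4) + v * (1 / 2 - v / 4))"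
    by (simp add: power2_eq_square field_simps)
  show ?case
    unfolding e(1) power_diff_step[OF assms] e(2) 3 v_def[symmetric] v
    by (simp add: field_simps)
qed simp

text \<open>After the factor x + y is split off, both initial quotients are the constant 1, and the
  recursion depends on v only through 2 v - v^2. This is what puts the even part into the form C(2 v
  - v^2).\<close>

lemma even_power_diff:
  fixes x y :: real
  assumes "x\<^sup>2 + y\<^sup>2 = 1"
  shows "x ^ (2 * i + 2) - y ^ (2 * i + 2)
    = (x - y) * (x + y) * poly (even_quot i) (2 * (x + y)\<^sup>2 - ((x + y)\<^sup>2)\<^sup>2)"
proof (induction i rule: even_quot.induct)
  case 2
  have "x ^ 4 - y ^ 4 = (x - y) * (x + y) * (x\<^sup>2 + y\<^sup>2)"
    by (simp add: power2_eq_square power4_eq_xxxx algebra_simps)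
  then show ?case using assms by simp
next
  case (3 i)
  have e: "2 * Suc (Suc i) + 2 = 2 * i + 2 + 4" "2 * i + 2 + 2 = 2 * Suc i + 2" by simp_all
  define v where "v = (x + y)\<^sup>2"
  have v: "(v - 1)\<^sup>2 / 4 = - (- (1 / 4) + (2 * v - v\<^sup>2) / 4)"
    by (simp add: power2_eq_square field_simps)
  show ?case
    unfolding e(1) power_diff_step[OF assms] e(2) 3 v_def[symmetric] v
    by (simp add: field_simps)
qed (simp add: power2_eq_square algebra_simps)

lemma degree_Suc_nonzero: "degree p = Suc k \<Longrightarrow> degree p = Suc k \<and> p \<noteq> 0"
  by auto

text \<open>The quadratic multiplier raises \<open>odd_quot i\<close> to degree i + 2, above the
  degree i + 1 of the other summand.\<close>

lemma degree_odd_quot: "degree (odd_quot i) = i \<and> odd_quot i \<noteq> 0"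
proof (induction i rule: odd_quot.induct)
  case (3 i)
  have "degree ([:- 1 / 4, 1 / 2, - 1 / 4:] * odd_quot i) = Suc (Suc i)"
    using 3 by (subst degree_mult_eq) auto
  with 3 have "degree (odd_quot (Suc (Suc i))) = Suc (Suc i)"
    unfolding odd_quot.simps by (subst degree_add_eq_right) auto
  then show ?case by (rule degree_Suc_nonzero)
qed auto

lemma degree_even_quot_le: "degree (even_quot i) \<le> i div 2"
proof (induction i rule: even_quot.induct)
  case (3 i)
  have "degree ([:- 1 / 4, 1 / 4:] * even_quot i) \<le> Suc (degree (even_quot i))"
    using degree_mult_le[of "[:- 1 / 4, 1 / 4:]" "even_quot i"] by simp
  with 3 show ?case
    unfolding even_quot.simps by (intro degree_add_le) auto
qed auto

text \<open>At even indices the summand with the linear multiplier has strictly larger degree, so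
  the degree is exact. At odd indices both summands can reach the same degree, where
  \<open>degree_even_quot_le\<close> gives a bound.\<close>

lemma degree_even_quot: "degree (even_quot (2 * i)) = i \<and> even_quot (2 * i) \<noteq> 0"
proof (induction i)
  case (Suc i)
  have e: "even_quot (2 * Suc i) = even_quot (Suc (2 * i)) + [:- 1 / 4, 1 / 4:] * even_quot (2 * i)"
    by simp
  have "degree ([:- 1 / 4, 1 / 4:] * even_quot (2 * i)) = Suc i"
    using Suc by (subst degree_mult_eq) auto
  moreover have "degree (even_quot (Suc (2 * i))) \<le> i"
    using degree_even_quot_le[of "Suc (2 * i)"] by simp
  ultimately have "degree (even_quot (2 * Suc i)) = Suc i"
    unfolding e by (subst degree_add_eq_right) linarith+
  then show ?case by (rule degree_Suc_nonzero)
qed auto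

lemma poly_eq_odd_even:
  fixes \<omega> :: "'a::comm_semiring_1 poly"
  assumes "degree \<omega> \<le> n"
  shows "poly \<omega> x = coeff \<omega> 0 + (\<Sum>i\<le>n. coeff \<omega> (2 * i + 1) * x ^ (2 * i + 1))
    + (\<Sum>i\<le>n. coeff \<omega> (2 * i + 2) * x ^ (2 * i + 2))"
proof -
  \<comment> \<open>Padding with zero coefficients up to 2 n + 2 gives both parities the same index
    range, whatever the parity of n.\<close>
  have "(\<Sum>k\<le>2 * n + 2. f k) = f 0 + (\<Sum>i\<le>n. f (2 * i + 1)) + (\<Sum>i\<le>n. f (2 * i + 2))" for f :: "nat \<Rightarrow> 'a"
    by (induction n) (simp_all add: numeral_2_eq_2 algebra_simps)
  from this[of "\<lambda>k. coeff \<omega> k * x ^ k"] show ?thesis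
    using poly_eq_sum_monoms[of \<omega> "2 * n + 2" x] assms by simp
qed

section \<open>Counting exponents and splitting integrands by parity\<close>

lemma card_filter_Suc:
  "card {k\<in>{1..Suc n}. P k} = (if P (Suc n) then 1 else 0) + card {k\<in>{1..n}. P k}"
proof -
  have "{k\<in>{1..Suc n}. P k} = (if P (Suc n) then insert (Suc n) else id) {k\<in>{1..n}. P k}"
    by (auto simp: le_Suc_eq)
  moreover have "Suc n \<notin> {k\<in>{1..n}. P k}" by simp
  moreover have "finite {k\<in>{1..n}. P k}" by simp
  ultimately show ?thesis
    by (cases "P (Suc n)") (simp_all only: if_True if_False card_insert_disjoint not_False_eq_True id_apply plus_1_eq_Suc add_0)
qed

lemma card_odd: "card {k\<in>{1..n}. odd k} = (n + 1) div 2"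
proof (induction n)
  case (Suc n)
  show ?case
    unfolding card_filter_Suc Suc.IH by (cases "even n") (auto elim!: evenE oddE)
qed simp

lemma card_not_4_dvd: "card {k\<in>{1..n}. \<not> 4 dvd k} = n - n div 4"
proof (induction n)
  case (Suc n)
  show ?case
    unfolding card_filter_Suc Suc.IH by (simp add: dvd_eq_mod_eq_0 div_Suc Suc_diff_le)
qed simp

text \<open>The family \<open>P\<close> is a parameter since the antipodal case takes
  \<open>monom 1\<close> and the orthogonal case \<open>odd_quot\<close>.\<close>

definition odd_part :: "(nat \<Rightarrow> real poly) \<Rightarrow> nat \<Rightarrow> real poly \<Rightarrow> real poly" where
  "odd_part P n \<omega> = (\<Sum>i\<le>n. smult (coeff \<omega> (2 * i + 1)) (P i))"

definition even_part :: "(nat \<Rightarrow> real poly) \<Rightarrow> nat \<Rightarrow> real poly \<Rightarrow> real poly" where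
  "even_part P n \<omega> = (\<Sum>i\<le>n. smult (coeff \<omega> (2 * i + 2)) (P i))"

lemma degree_odd_part:
  assumes "degree \<omega> \<le> n" "\<And>i. degree (P i) = i"
  shows "degree (odd_part P n \<omega>) \<le> (n - 1) div 2"
  unfolding odd_part_def
proof (rule degree_sum_le)
  show "degree (smult (coeff \<omega> (2 * i + 1)) (P i)) \<le> (n - 1) div 2" for i
  proof (cases "2 * i + 1 \<le> n")
    case True
    then show ?thesis by (intro order_trans[OF degree_smult_le]) (simp add: assms(2))
  next
    case False
    then show ?thesis using assms(1) by (simp add: coeff_eq_0)
  qed
qed simp

lemma degree_even_part:
  assumes "degree \<omega> \<le> n"
  shows "degree (even_part even_quot n \<omega>) \<le> (n - 2) div 4"
  unfolding even_part_def
proof (rule degree_sum_le)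
  show "degree (smult (coeff \<omega> (2 * i + 2)) (even_quot i)) \<le> (n - 2) div 4" for i
  proof (cases "2 * i + 2 \<le> n")
    case True
    then have "i div 2 \<le> (n - 2) div 4" by linarith
    then show ?thesis
      using degree_even_quot_le[of i] degree_smult_le order_trans by metis
  next
    case False
    then show ?thesis using assms(1) by (simp add: coeff_eq_0)
  qed
qed simp

lemma odd_part_eq_0:
  assumes "odd_part P n \<omega> = 0" "degree \<omega> \<le> n" "\<And>i. degree (P i) = i" "\<And>i. P i \<noteq> 0"
  shows "coeff \<omega> (2 * i + 1) = 0"
proof (cases "i \<le> n")
  case True
  then show ?thesis
    using smult_sum_eq_0_distinct_degrees[of "{..n}" P "\<lambda>i. coeff \<omega> (2 * i + 1)" i] assms
    by (simp add: odd_part_def)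
qed (use assms in \<open>simp add: coeff_eq_0\<close>)

text \<open>For odd i the exponent 2 i + 2 is a multiple of 4, so only even i survive. Their
  quotients have the distinct degrees i div 2 and are therefore independent.\<close>

lemma even_part_eq_0:
  assumes "even_part even_quot n \<omega> = 0" "degree \<omega> \<le> n" "\<And>k. 4 dvd k \<Longrightarrow> coeff \<omega> k = 0"
  shows "coeff \<omega> (2 * i + 2) = 0"
proof (cases "even i \<and> i \<le> n")
  case True
  have vanish: "coeff \<omega> (2 * i + 2) = 0" if "odd i" for i
  proof (rule assms(3))
    from that show "4 dvd 2 * i + 2" by presburger
  qed
  have deg: "degree (even_quot i) = i div 2 \<and> even_quot i \<noteq> 0" if "even i" for i
    using that degree_even_quot by (auto elim!: evenE)
  have "(\<Sum>i\<in>{i\<in>{..n}. even i}. smult (coeff \<omega> (2 * i + 2)) (even_quot i)) = even_part even_quot n \<omega>"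
    unfolding even_part_def by (rule sum.mono_neutral_left) (auto simp: vanish[simplified])
  then have "(\<Sum>i\<in>{i\<in>{..n}. even i}. smult (coeff \<omega> (2 * i + 2)) (even_quot i)) = 0"
    using assms(1) by simp
  moreover have "inj_on (\<lambda>i. degree (even_quot i)) {i\<in>{..n}. even i}"
    by (rule inj_onI) (auto simp: deg elim!: evenE)
  ultimately show ?thesis
    using True deg smult_sum_eq_0_distinct_degrees[of "{i\<in>{..n}. even i}" even_quot "\<lambda>i. coeff \<omega> (2 * i + 2)" i]
    by simp
next
  case False
  then consider "odd i" | "i > n" by linarith
  then show ?thesis
  proof cases
    case 1
    then have "4 dvd 2 * i + 2" by presburger
    then show ?thesis by (rule assms(3))
  qed (use assms(2) in \<open>simp add: coeff_eq_0\<close>)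
qed

lemma poly_diff_antipodal:
  assumes "degree \<omega> \<le> n"
  shows "poly \<omega> x - poly \<omega> (- x) = 2 * x * poly (odd_part (monom 1) n \<omega>) (x\<^sup>2)"
  unfolding poly_eq_odd_even[OF assms] odd_part_def
  by (simp add: poly_sum poly_monom sum_distrib_left sum_negf flip: power_mult)
    (simp add: mult_ac)

lemma poly_diff_orthogonal:
  assumes "degree \<omega> \<le> n" "x\<^sup>2 + y\<^sup>2 = 1"
  defines "v \<equiv> (x + y)\<^sup>2"
  shows "poly \<omega> x - poly \<omega> y
    = (x - y) * (poly (odd_part odd_quot n \<omega>) v + (x + y) * poly (even_part even_quot n \<omega>) (2 * v - v\<^sup>2))"
proof -
  have "poly \<omega> x - poly \<omega> y = (\<Sum>i\<le>n. coeff \<omega> (2 * i + 1) * (x ^ (2 * i + 1) - y ^ (2 * i + 1)))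
      + (\<Sum>i\<le>n. coeff \<omega> (2 * i + 2) * (x ^ (2 * i + 2) - y ^ (2 * i + 2)))"
    unfolding poly_eq_odd_even[OF assms(1)] by (simp only: right_diff_distrib sum_subtractf)
  also have "(\<Sum>i\<le>n. coeff \<omega> (2 * i + 1) * (x ^ (2 * i + 1) - y ^ (2 * i + 1)))
      = (x - y) * poly (odd_part odd_quot n \<omega>) v"
    unfolding odd_power_diff[OF assms(2)] v_def odd_part_def
    by (simp only: poly_sum poly_smult sum_distrib_left mult.left_commute)
  also have "(\<Sum>i\<le>n. coeff \<omega> (2 * i + 2) * (x ^ (2 * i + 2) - y ^ (2 * i + 2)))
      = (x - y) * (x + y) * poly (even_part even_quot n \<omega>) (2 * v - v\<^sup>2)"
    unfolding even_power_diff[OF assms(2)] v_def even_part_def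
    by (simp only: poly_sum poly_smult sum_distrib_left mult.left_commute)
  finally show ?thesis by (simp add: algebra_simps)
qed

section \<open>The two types of cycle families\<close>

lemma connected_closedin_cover:
  assumes "connected S" "closedin (top_of_set S) A" "closedin (top_of_set S) B"
    and "A \<union> B = S" "A \<inter> B = {}"
  shows "A = {} \<or> B = {}"
  using assms unfolding connected_closedin_eq by blast

text \<open>Subtracting the two fibre equations gives (X - Y) (X + Y) (X^2 + Y^2 - 1) = 0 with
  nonzero first factor. Both other factors vanish together only if X^2 = 1/2, which is the excluded
  critical value t = -1/4. So the interval is covered by two disjoint closed sets.\<close>

lemma cycle_antipodal_or_orthogonal:
  fixes X Y :: "real \<Rightarrow> real"
  assumes cont: "continuous_on {-1/4<..<0} X" "continuous_on {-1/4<..<0} Y"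
    and fib: "\<And>t. t \<in> {-1/4<..<0} \<Longrightarrow> X t ^ 4 - X t ^ 2 = t \<and> Y t ^ 4 - Y t ^ 2 = t \<and> X t \<noteq> Y t"
  shows "(\<forall>t\<in>{-1/4<..<0}. Y t = - X t) \<or>
    (\<forall>t\<in>{-1/4<..<0}. X t ^ 2 + Y t ^ 2 = 1 \<and> X t + Y t \<noteq> 0)"
proof -
  let ?J = "{-1/4<..<0::real}"
  let ?A = "{t\<in>?J. X t + Y t = 0}" and ?B = "{t\<in>?J. X t ^ 2 + Y t ^ 2 = 1}"
  have closed: "closedin (top_of_set ?J) ?A" "closedin (top_of_set ?J) ?B"
    by (intro continuous_closedin_preimage_constant continuous_intros cont)+
  have cover: "?A \<union> ?B = ?J"
  proof -
    have "X t + Y t = 0 \<or> X t ^ 2 + Y t ^ 2 = 1" if "t \<in> ?J" for t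
    proof -
      have "(X t - Y t) * (X t + Y t) * (X t ^ 2 + Y t ^ 2 - 1) = (X t ^ 4 - X t ^ 2) - (Y t ^ 4 - Y t ^ 2)"
        by (simp add: power2_eq_square power4_eq_xxxx algebra_simps)
      also have "\<dots> = 0" using fib[OF that] by simp
      finally show ?thesis using fib[OF that] by simp
    qed
    then show ?thesis by blast
  qed
  have disj: "?A \<inter> ?B = {}"
  proof -
    have "X t ^ 2 + Y t ^ 2 \<noteq> 1" if "t \<in> ?J" "X t + Y t = 0" for t
    proof
      assume "X t ^ 2 + Y t ^ 2 = 1"
      moreover have "Y t = - X t" using that(2) by simp
      ultimately have half: "X t ^ 2 = 1 / 2" by simp
      have "X t ^ 4 = (X t ^ 2) ^ 2" by simp
      then have "X t ^ 4 - X t ^ 2 = - 1 / 4" unfolding half by (simp add: power2_eq_square)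
      then show False using fib[OF that(1)] that(1) by simp
    qed
    then show ?thesis by blast
  qed
  have "connected ?J" by simp
  then have "?A = {} \<or> ?B = {}"
    using closed cover disj by (rule connected_closedin_cover)
  then show ?thesis
  proof
    assume "?A = {}"
    then show ?thesis using cover by blast
  next
    assume "?B = {}"
    then have zero: "X t + Y t = 0" if "t \<in> ?J" for t using cover that by blast
    have "Y t = - X t" if "t \<in> ?J" for t using zero[OF that] by linarith
    then show ?thesis by blast
  qed
qed

text \<open>By connectedness f keeps its sign, which is \<epsilon>. This allows X + Y to be replaced
  by a constant times sqrt v.\<close>

lemma continuous_nonzero_eq_sqrt:
  fixes f :: "real \<Rightarrow> real"
  assumes "connected J" "continuous_on J f" "\<And>t. t \<in> J \<Longrightarrow> f t \<noteq> 0"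
  obtains \<epsilon> where "\<epsilon> \<noteq> 0" "\<And>t. t \<in> J \<Longrightarrow> f t = \<epsilon> * sqrt ((f t)\<^sup>2)"
proof -
  have conn: "connected (f ` J)" using assms(2,1) by (rule connected_continuous_image)
  have same_sign: "f t > 0" if "s \<in> J" "t \<in> J" "f s > 0" for s t
  proof (rule ccontr)
    assume "\<not> f t > 0"
    then have "0 \<in> f ` J"
      using that by (intro connectedD_interval[OF conn, of "f t" "f s" 0]) simp_all
    then show False using assms(3) by fastforce
  qed
  show ?thesis
  proof (cases "\<exists>s\<in>J. f s > 0")
    case True
    then obtain s where "s \<in> J" "f s > 0" by blast
    then have "f t = 1 * sqrt ((f t)\<^sup>2)" if "t \<in> J" for t
      using same_sign[of s t] that by simp
    then show ?thesis by (rule that[OF one_neq_zero])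
  next
    case False
    show ?thesis
    proof (rule that[of "- 1"])
      fix t assume "t \<in> J"
      with False have "f t \<le> 0" by (simp add: not_less)
      then show "f t = - 1 * sqrt ((f t)\<^sup>2)" by (simp add: abs_of_nonpos)
    qed simp
  qed
qed

text \<open>With q = (n - 2) div 4 and r the remainder, both sides are explicit in q for each r. The
  first inequality always holds with difference one: n - n div 4 is the number of coefficients
  available to E and C together. The second is equally tight for r = 0.\<close>

lemma degree_bounds_lt_card:
  fixes n :: nat
  assumes "n \<ge> 2"
  shows "(n - 1) div 2 + (n - 2) div 4 + 1 < n - n div 4" "3 * ((n - 2) div 4) + 1 < n - n div 4"
proof -
  obtain q r where n: "n = 4 * q + r + 2" and "r < 4"
  proof
    show "n = 4 * ((n - 2) div 4) + (n - 2) mod 4 + 2"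
      using assms by simp
  qed simp
  from \<open>r < 4\<close> consider "r = 0" | "r = 1" | "r = 2" | "r = 3" by linarith
  then show "(n - 1) div 2 + (n - 2) div 4 + 1 < n - n div 4" "3 * ((n - 2) div 4) + 1 < n - n div 4"
    unfolding n by (cases; simp)+
qed

theorem proposition6:
  fixes x\<^sub>i x\<^sub>j :: "real \<Rightarrow> complex" and n :: nat
  assumes "simple_cycle_family f0 {-1/4<..<0} x\<^sub>i x\<^sub>j"
    and "n \<ge> 1"
  shows "chebyshev {-1/4<..<0} (abelian_integrals {-1/4<..<0} x\<^sub>i x\<^sub>j n)"
proof -
  define J where "J = {-1/4<..<0::real}"
  define X where "X t = Re (x\<^sub>i t)" for t
  define Y where "Y t = Re (x\<^sub>j t)" for t
  have fam: "continuous_on J x\<^sub>i" "continuous_on J x\<^sub>j"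
    "\<And>t. t \<in> J \<Longrightarrow> cpoly f0 (x\<^sub>i t) = of_real t" "\<And>t. t \<in> J \<Longrightarrow> cpoly f0 (x\<^sub>j t) = of_real t"
    "\<And>t. t \<in> J \<Longrightarrow> x\<^sub>i t \<noteq> x\<^sub>j t"
    using assms(1) unfolding simple_cycle_family_def J_def[symmetric] by blast+
  have bounds: "-1/4 < t" "t < 0" if "t \<in> J" for t using that by (auto simp: J_def)
  have xi: "x\<^sub>i t = of_real (X t)" "X t ^ 4 - X t ^ 2 = t" if "t \<in> J" for t
    unfolding X_def by (rule f0_fibre_real[OF fam(3)[OF that] bounds[OF that]])+
  have xj: "x\<^sub>j t = of_real (Y t)" "Y t ^ 4 - Y t ^ 2 = t" if "t \<in> J" for t
    unfolding Y_def by (rule f0_fibre_real[OF fam(4)[OF that] bounds[OF that]])+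
  have neq: "X t \<noteq> Y t" if "t \<in> J" for t
    using fam(5)[OF that] xi(1)[OF that] xj(1)[OF that] by metis
  have cont: "continuous_on J X" "continuous_on J Y"
    unfolding X_def Y_def by (intro continuous_intros fam)+
  have integral: "abelian_integral J x\<^sub>i x\<^sub>j \<omega> t = of_real (poly \<omega> (X t) - poly \<omega> (Y t))" if "t \<in> J" for t \<omega>
    using that by (simp add: abelian_integral_def xi(1) xj(1) cpoly_of_real)
  \<comment> \<open>\<open>fill\<close> supplies \<open>card K\<close> points, so that
    \<open>key\<close> also applies to integrals vanishing on all of \<open>J\<close>.\<close>
  have "infinite J" by (simp add: J_def)
  then have fill: "\<exists>T\<subseteq>J. finite T \<and> card T = m" for m
    using infinite_arbitrarily_large[of J m] by blast
  consider (antipodal) "\<And>t. t \<in> J \<Longrightarrow> Y t = - X t"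
    | (orthogonal) "\<And>t. t \<in> J \<Longrightarrow> X t ^ 2 + Y t ^ 2 = 1 \<and> X t + Y t \<noteq> 0"
    using cycle_antipodal_or_orthogonal[of X Y] cont xi xj neq unfolding J_def by blast
  then have "chebyshev J (abelian_integrals J x\<^sub>i x\<^sub>j n)"
  proof cases
    case antipodal
    \<comment> \<open>Even powers cancel between X and -X.\<close>
    define K where "K = {k\<in>{1..n}. odd k}"
    have I: "abelian_integral J x\<^sub>i x\<^sub>j \<omega> t = of_real (2 * X t * poly (odd_part (monom 1) n \<omega>) ((X t)\<^sup>2))"
      if "t \<in> J" "degree \<omega> \<le> n" for t \<omega>
      unfolding integral[OF that(1)] antipodal[OF that(1)] poly_diff_antipodal[OF that(2)] ..
    have key: "odd_part (monom 1) n \<omega> = 0"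
      if \<omega>: "degree \<omega> \<le> n" and T: "finite T" "T \<subseteq> J" "card T = card K"
        and zero: "\<forall>t\<in>T. abelian_integral J x\<^sub>i x\<^sub>j \<omega> t = 0" for \<omega> T
    proof (rule poly_eqI_degree)
      have "inj_on (\<lambda>t. (X t)\<^sup>2) T"
      proof (rule inj_onI)
        have X_t: "t = ((X t)\<^sup>2)\<^sup>2 - (X t)\<^sup>2" if "t \<in> T" for t
          using xi(2)[of t] that T(2) by auto
        fix s t assume "s \<in> T" "t \<in> T" "(X s)\<^sup>2 = (X t)\<^sup>2"
        then show "s = t" using X_t by metis
      qed
      then have "card ((\<lambda>t. (X t)\<^sup>2) ` T) = (n + 1) div 2"
        using T(3) card_odd by (simp add: card_image K_def)
      then show "degree (odd_part (monom 1) n \<omega>) < card ((\<lambda>t. (X t)\<^sup>2) ` T)"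
        "degree (0 :: real poly) < card ((\<lambda>t. (X t)\<^sup>2) ` T)"
        using degree_odd_part[OF \<omega>, of "monom 1"] assms(2) by (simp_all add: degree_monom_eq)
      fix v assume "v \<in> (\<lambda>t. (X t)\<^sup>2) ` T"
      then obtain t where t: "t \<in> T" "v = (X t)\<^sup>2" by blast
      \<comment> \<open>X = 0 would give t = 0, outside the interval.\<close>
      then have "X t \<noteq> 0" using xi(2)[of t] T(2) by (auto simp: J_def)
      then show "poly (odd_part (monom 1) n \<omega>) v = poly 0 v"
        using zero t T(2) I[of t \<omega>] \<omega> by auto
    qed
    show ?thesis
    proof (rule chebyshev_abelian_integralsI)
      show "K \<subseteq> {..n}" by (auto simp: K_def)
      show "\<forall>t\<in>J. abelian_integral J x\<^sub>i x\<^sub>j \<omega> t = 0"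
        if "degree \<omega> \<le> n" "finite T" "T \<subseteq> J" "card T = card K"
          "\<forall>t\<in>T. abelian_integral J x\<^sub>i x\<^sub>j \<omega> t = 0" for \<omega> T
        using key[OF that] I that(1) by simp
      show "\<omega> = 0" if \<omega>: "degree \<omega> \<le> n" "\<And>k. k \<notin> K \<Longrightarrow> coeff \<omega> k = 0"
        "\<forall>t\<in>J. abelian_integral J x\<^sub>i x\<^sub>j \<omega> t = 0" for \<omega>
      proof (rule poly_eqI)
        fix k :: nat
        have "odd_part (monom 1) n \<omega> = 0"
          using fill[of "card K"] key[OF \<omega>(1)] \<omega>(3) by blast
        then have "coeff \<omega> k = 0" if "odd k"
          using odd_part_eq_0[OF _ \<omega>(1), of "monom 1" "k div 2"] that by (simp add: degree_monom_eq)
        then show "coeff \<omega> k = coeff 0 k" using \<omega>(2)[of k] by (auto simp: K_def)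
      qed
    qed
  next
    case orthogonal
    \<comment> \<open>Exponents 2 i + 2 with i odd add nothing new: \<open>even_quot i\<close> has
      degree at most i div 2, and the quotients at smaller even indices realise every degree up to
      that. The exponent 0 drops out because constants cancel.\<close>
    define K where "K = {k\<in>{1..n}. \<not> 4 dvd k}"
    let ?E = "odd_part odd_quot n" and ?C = "even_part even_quot n"
    define v where "v t = (X t + Y t)\<^sup>2" for t
    have I: "abelian_integral J x\<^sub>i x\<^sub>j \<omega> t
        = of_real ((X t - Y t) * (poly (?E \<omega>) (v t) + (X t + Y t) * poly (?C \<omega>) (2 * v t - (v t)\<^sup>2)))"
      if "t \<in> J" "degree \<omega> \<le> n" for t \<omega>
      unfolding v_def integral[OF that(1)]
        poly_diff_orthogonal[OF that(2) conjunct1[OF orthogonal[OF that(1)]]] ..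
    obtain \<epsilon> where \<epsilon>: "\<epsilon> \<noteq> 0" "\<And>t. t \<in> J \<Longrightarrow> X t + Y t = \<epsilon> * sqrt (v t)"
      using continuous_nonzero_eq_sqrt[of J "\<lambda>t. X t + Y t"] orthogonal cont
      unfolding v_def by (auto simp: J_def intro: continuous_on_add)
    have v_t: "t = - ((v t - 1)\<^sup>2 / 4)" if "t \<in> J" for t
    proof -
      have "v t - 1 = 2 * X t * Y t"
        using orthogonal[OF that] by (simp add: v_def power2_sum)
      then have "(v t - 1)\<^sup>2 / 4 = (X t)\<^sup>2 * (Y t)\<^sup>2" by (simp add: power_mult_distrib)
      also have "(Y t)\<^sup>2 = 1 - (X t)\<^sup>2" using orthogonal[OF that] by simp
      also have "(X t)\<^sup>2 * (1 - (X t)\<^sup>2) = - (X t ^ 4 - (X t)\<^sup>2)"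
        by (simp add: power2_eq_square power4_eq_xxxx algebra_simps)
      finally show ?thesis using xi(2)[OF that] by simp
    qed
    have key: "?E \<omega> = 0 \<and> ?C \<omega> = 0"
      if \<omega>: "degree \<omega> \<le> n" and T: "finite T" "T \<subseteq> J" "card T = card K"
        and zero: "\<forall>t\<in>T. abelian_integral J x\<^sub>i x\<^sub>j \<omega> t = 0" for \<omega> T
    proof -
      have "inj_on v T"
      proof (rule inj_onI)
        fix s t assume st: "s \<in> T" "t \<in> T" "v s = v t"
        have "s = - ((v s - 1)\<^sup>2 / 4)" using v_t st(1) T(2) by blast
        also have "\<dots> = t" using v_t[of t] st T(2) by auto
        finally show "s = t" .
      qed
      then have card: "card (v ` T) = n - n div 4"
        using T(3) card_not_4_dvd by (simp add: card_image K_def)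
      \<comment> \<open>The constant sign of X + Y is absorbed into C, which leaves sqrt v as the
        factor.\<close>
      have "?E \<omega> = 0 \<and> smult \<epsilon> (?C \<omega>) = 0"
      proof (rule few_positive_zeros)
        show "finite (v ` T)" using T by simp
        show "v ` T \<subseteq> {0<..}" using orthogonal T(2) by (auto simp: v_def)
        show "poly (?E \<omega>) s + sqrt s * poly (smult \<epsilon> (?C \<omega>)) (2 * s - s\<^sup>2) = 0" if s: "s \<in> v ` T" for s
        proof -
          from s obtain t where t: "t \<in> T" "s = v t" by blast
          with T(2) have "t \<in> J" by blast
          then have "(X t - Y t) * (poly (?E \<omega>) s + (X t + Y t) * poly (?C \<omega>) (2 * s - s\<^sup>2)) = 0"
            using zero t(1) unfolding t(2) of_real_eq_0_iff[where 'a = complex, symmetric]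
            by (subst I[OF _ \<omega>, symmetric]) blast+
          then show ?thesis
            using neq[OF \<open>t \<in> J\<close>] \<epsilon>(2)[OF \<open>t \<in> J\<close>] t(2) by (simp add: mult_ac)
        qed
        have E: "degree (?E \<omega>) \<le> (n - 1) div 2"
          using degree_odd_part[OF \<omega>, of odd_quot] by (simp add: degree_odd_quot)
        moreover have "(n - 1) div 2 < n - n div 4" using assms(2) by linarith
        ultimately show "degree (?E \<omega>) < card (v ` T)" unfolding card by linarith
        show "smult \<epsilon> (?C \<omega>) = 0 \<or> degree (?E \<omega>) + degree (smult \<epsilon> (?C \<omega>)) + 1 < card (v ` T) \<and>
          3 * degree (smult \<epsilon> (?C \<omega>)) + 1 < card (v ` T)"
        \<comment> \<open>For n = 1 there is a single point, too few for the strict inequalities,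
          but \<omega> has no even powers beyond the constant and so C = 0.\<close>
        proof (cases "n = 1")
          case True
          then have "coeff \<omega> (2 * i + 2) = 0" for i using \<omega> by (simp add: coeff_eq_0)
          then show ?thesis by (simp add: even_part_def)
        next
          case False
          have "degree (smult \<epsilon> (?C \<omega>)) \<le> (n - 2) div 4"
            using degree_even_part[OF \<omega>] by (rule order_trans[OF degree_smult_le])
          moreover have "n \<ge> 2" using False assms(2) by simp
          note degree_bounds_lt_card[OF this]
          ultimately show ?thesis using E unfolding card by linarith
        qed
      qed
      then show ?thesis using \<epsilon>(1) by simp
    qed
    show ?thesis
    proof (rule chebyshev_abelian_integralsI)
      show "K \<subseteq> {..n}" by (auto simp: K_def)
      show "\<forall>t\<in>J. abelian_integral J x\<^sub>i x\<^sub>j \<omega> t = 0"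
        if "degree \<omega> \<le> n" "finite T" "T \<subseteq> J" "card T = card K"
          "\<forall>t\<in>T. abelian_integral J x\<^sub>i x\<^sub>j \<omega> t = 0" for \<omega> T
        using key[OF that] I that(1) by simp
      show "\<omega> = 0" if \<omega>: "degree \<omega> \<le> n" "\<And>k. k \<notin> K \<Longrightarrow> coeff \<omega> k = 0"
        "\<forall>t\<in>J. abelian_integral J x\<^sub>i x\<^sub>j \<omega> t = 0" for \<omega>
      proof (rule poly_eqI)
        fix k :: nat
        have parts: "?E \<omega> = 0" "?C \<omega> = 0"
          using fill[of "card K"] key[OF \<omega>(1)] \<omega>(3) by blast+
        have mult4: "coeff \<omega> k = 0" if "4 dvd k" for k :: nat
          using \<omega>(2)[of k] that by (simp add: K_def)
        consider "k = 0" | i where "k = 2 * i + 1" | i where "k = 2 * i + 2"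
        proof (cases "even k")
          case True
          then obtain m where "k = 2 * m" by (rule evenE)
          then show ?thesis using that(1) that(3)[of "m - 1"] by (cases m) simp_all
        next
          case False
          then show ?thesis using that(2) by (auto elim: oddE)
        qed
        then have "coeff \<omega> k = 0"
        proof cases
          case 1
          then show ?thesis using mult4 by simp
        next
          case 2
          then show ?thesis using odd_part_eq_0[OF parts(1) \<omega>(1)] by (simp add: degree_odd_quot)
        next
          case 3
          then show ?thesis using even_part_eq_0[OF parts(2) \<omega>(1) mult4] by simp
        qed
        then show "coeff \<omega> k = coeff 0 k" by simp
      qed
    qed
  qed
  then show ?thesis unfolding J_def .
qed

end
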